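(* Let $f(x)=\sum_{n\ge 1} a_n x^n$, where $a_n$ is the number of permutations of length $n$ that avoid both $4231$ and $3124$. Then \[ f(x)=\frac{1-8x+20x^2-20x^3+10x^4-2x^5-(1-4x+2x^2)\sqrt{1-4x}}{2(1-3x+x^2)(-1+5x-4x^2+x^3)}. \]
   Context: A permutation $\pi$ avoids $\sigma$ if no subsequence of $\pi$ is order-isomorphic to $\sigma$. The generating function counts nonempty permutations only (no constant term). *)

theory Defs
  imports "HOL-Computational_Algebra.Formal_Power_Series"
begin

definition perms_of_len :: "nat \<Rightarrow> nat list set" where
  "perms_of_len n = {xs. distinct xs \<and> set xs = {1..n}}"

definition order_iso :: "nat list \<Rightarrow> nat list \<Rightarrow> bool" where
  "order_iso ys s \<longleftrightarrow> length ys = length s \<and>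
     (\<forall>i<length s. \<forall>j<length s. (ys ! i < ys ! j) \<longleftrightarrow> (s ! i < s ! j))"

definition contains :: "nat list \<Rightarrow> nat list \<Rightarrow> bool" where
  "contains p s \<longleftrightarrow> (\<exists>ys \<in> set (subseqs p). order_iso ys s)"

definition avoids :: "nat list \<Rightarrow> nat list \<Rightarrow> bool" where
  "avoids p s \<longleftrightarrow> \<not> contains p s"

definition a_4231_3124 :: "nat \<Rightarrow> nat" where
  "a_4231_3124 n = card {p \<in> perms_of_len n. avoids p [4,2,3,1] \<and> avoids p [3,1,2,4]}"

definition gf_4231_3124 :: "real fps" where
  "gf_4231_3124 = Abs_fps (\<lambda>n. if n = 0 then 0 else real (a_4231_3124 n))"

(* the formal power series sqrt(1-4x) with constant term 1 *)
definition sqrt_1m4x :: "real fps" where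
  "sqrt_1m4x = fps_radical (\<lambda>_ _. 1) 2 (1 - 4 * fps_X)"

end

theory Submission
  imports Defs "HOL-Library.Sublist"
begin

text \<open>
  Grow permutations by appending a last entry: the new entry is placed in a gap \<open>g\<close>, just above \<open>g\<close>
  old values. Since 4231 and 3124 both end in a copy of 312 followed by one entry, a gap \<open>h\<close> stays usable
  as long as every occurrence \<open>a b c\<close> of 312 satisfies \<open>b \<le> h < a\<close>.

  A 312-avoider has the form \<open>\<alpha> \<beta> v\<close> with \<open>\<alpha> < v < \<beta>\<close>, hence it is a binary search tree, and all its gaps are
  usable. When an entry placed in gap \<open>s\<close> first creates a 312, the usable gaps collapse to an interval
  that sees only the left subtree of the node \<open>s\<close> (in inorder), together with the new entry.
  From then on a state is a tree with a decreasing sequence of \<open>m\<close> entries above it, and a further entry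
  either goes among the decreasing ones (the tree is lost and \<open>m\<close> becomes 1), or between tree
  and sequence (\<open>m\<close> increases), or into a gap of the tree (passing to a left subtree, with \<open>m = 1\<close>).
  The number of descendants of a state is affine in \<open>m\<close> and additive over the tree, so that summing over all trees
  gives linear equations over the Catalan series.
\<close>

unbundle fps_syntax

subsection \<open>Appending a last entry\<close>

lemma subseq_snoc_iff:
  "subseq (xs @ [x]) (ys @ [y]) \<longleftrightarrow> subseq (xs @ [x]) ys \<or> x = y \<and> subseq xs ys"
proof
  assume "subseq (xs @ [x]) (ys @ [y])"
  then obtain us vs where uv: "xs @ [x] = us @ vs" "subseq us ys" "subseq vs [y]"
    by (auto simp: subseq_append_iff)
  show "subseq (xs @ [x]) ys \<or> x = y \<and> subseq xs ys"
  proof (cases vs rule: rev_cases)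
    case Nil
    with uv show ?thesis by simp
  next
    case (snoc ws w)
    with uv(3) have "ws = [] \<and> w = y"
      by (cases ws) (auto split: if_splits)
    with snoc uv show ?thesis by simp
  qed
next
  assume "subseq (xs @ [x]) ys \<or> x = y \<and> subseq xs ys"
  then show "subseq (xs @ [x]) (ys @ [y])"
    by (auto intro: subseq_rev_drop_many)
qed

lemma subseq_map_iff: "subseq xs (map f ys) \<longleftrightarrow> (\<exists>zs. xs = map f zs \<and> subseq zs ys)"
  unfolding subseq_conv_nths nths_map by metis

lemma contains_4231_iff:
  "contains p [4,2,3,1] \<longleftrightarrow> (\<exists>a b c d. subseq [a,b,c,d] p \<and> d < b \<and> b < c \<and> c < a)"
proof -
  have iso: "order_iso ys [4,2,3,1] \<longleftrightarrow> (\<exists>a b c d. ys = [a,b,c,d] \<and> d < b \<and> b < c \<and> c < a)" for ys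
    unfolding order_iso_def
    by (auto simp: All_less_Suc numeral_eq_Suc length_Suc_conv)
  show ?thesis
    unfolding contains_def Bex_def in_set_subseqs iso by blast
qed

lemma contains_3124_iff:
  "contains p [3,1,2,4] \<longleftrightarrow> (\<exists>a b c d. subseq [a,b,c,d] p \<and> b < c \<and> c < a \<and> a < d)"
proof -
  have iso: "order_iso ys [3,1,2,4] \<longleftrightarrow> (\<exists>a b c d. ys = [a,b,c,d] \<and> b < c \<and> c < a \<and> a < d)" for ys
    unfolding order_iso_def
    by (auto simp: All_less_Suc numeral_eq_Suc length_Suc_conv)
  show ?thesis
    unfolding contains_def Bex_def in_set_subseqs iso by blast
qed

definition in_class :: "nat list \<Rightarrow> bool" where
  "in_class p \<longleftrightarrow> avoids p [4,2,3,1] \<and> avoids p [3,1,2,4]"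

definition class_of_len :: "nat \<Rightarrow> nat list set" where
  "class_of_len n = {p \<in> perms_of_len n. in_class p}"

definition gap_shift :: "nat \<Rightarrow> nat \<Rightarrow> nat" where
  "gap_shift g x = (if x \<le> g then x else Suc x)"

definition gap_insert :: "nat \<Rightarrow> nat list \<Rightarrow> nat list" where
  "gap_insert g p = map (gap_shift g) p @ [Suc g]"

text \<open>Sends a gap of the grown permutation to the gap of the old one that contains it; the two
  gaps \<open>g\<close> and \<open>Suc g\<close> around the new entry both go to
  \<open>g\<close>.\<close>

definition gap_collapse :: "nat \<Rightarrow> nat \<Rightarrow> nat" where
  "gap_collapse g h = (if h \<le> g then h else h - 1)"

text \<open>The gap \<open>h\<close> is not ruled out by the 312s created when an entry is put into gap \<open>g\<close>.\<close>
definition compatible :: "nat list \<Rightarrow> nat \<Rightarrow> nat \<Rightarrow> bool" where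
  "compatible p g h \<longleftrightarrow> (\<forall>a b. subseq [a,b] p \<longrightarrow> b \<le> g \<longrightarrow> g < a \<longrightarrow> b \<le> h \<and> h < a)"

definition active :: "nat list \<Rightarrow> nat \<Rightarrow> bool" where
  "active p h \<longleftrightarrow> h \<le> length p \<and>
     (\<forall>a b c. subseq [a,b,c] p \<longrightarrow> b < c \<longrightarrow> c < a \<longrightarrow> b \<le> h \<and> h < a)"

lemma gap_shift_less_iff [simp]: "gap_shift g x < gap_shift g y \<longleftrightarrow> x < y"
  by (auto simp: gap_shift_def)

lemma inj_gap_shift: "inj (gap_shift g)"
  by (rule injI) (auto simp: gap_shift_def split: if_splits)

lemma gap_shift_neq [simp]: "Suc g \<noteq> gap_shift g x"
  by (auto simp: gap_shift_def)

lemma gap_shift_less_Suc [simp]: "gap_shift g x < Suc g \<longleftrightarrow> x \<le> g" "Suc g < gap_shift g x \<longleftrightarrow> g < x"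
  by (auto simp: gap_shift_def)

lemma gap_shift_le_iff [simp]: "gap_shift g x \<le> h \<longleftrightarrow> x \<le> gap_collapse g h"
  "h < gap_shift g x \<longleftrightarrow> gap_collapse g h < x"
  by (auto simp: gap_shift_def gap_collapse_def)

lemma gap_collapse_simps [simp]:
  "gap_collapse g (gap_shift g x) = x" "gap_collapse g (Suc g) = g" "gap_collapse g g = g"
  by (auto simp: gap_shift_def gap_collapse_def)

lemma length_gap_insert [simp]: "length (gap_insert g p) = Suc (length p)"
  by (simp add: gap_insert_def)

text \<open>Peels a witness list one element at a time, so that unfolding replaces quantification
  over lists by quantification over entries.\<close>

lemma ex_Cons_eq_map_iff:
  "(\<exists>zs. x # xs = map f zs \<and> P zs) \<longleftrightarrow> (\<exists>z. x = f z \<and> (\<exists>zs. xs = map f zs \<and> P (z # zs)))"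
  by (metis Cons_eq_map_conv list.simps(9))

lemma subseq4_gap_insert:
  "subseq [a,b,c,d] (gap_insert g p) \<longleftrightarrow>
     (\<exists>a' b' c' d'. subseq [a',b',c',d'] p \<and> a = gap_shift g a' \<and> b = gap_shift g b' \<and> c = gap_shift g c' \<and> d = gap_shift g d')
   \<or> (\<exists>a' b' c'. subseq [a',b',c'] p \<and> a = gap_shift g a' \<and> b = gap_shift g b' \<and> c = gap_shift g c' \<and> d = Suc g)"
  using subseq_snoc_iff[of "[a,b,c]" d "map (gap_shift g) p" "Suc g"]
  unfolding gap_insert_def subseq_map_iff append_Cons append_Nil ex_Cons_eq_map_iff
  by (simp cong: conj_cong) blast

lemma subseq3_gap_insert:
  "subseq [a,b,c] (gap_insert g p) \<longleftrightarrow>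
     (\<exists>a' b' c'. subseq [a',b',c'] p \<and> a = gap_shift g a' \<and> b = gap_shift g b' \<and> c = gap_shift g c')
   \<or> (\<exists>a' b'. subseq [a',b'] p \<and> a = gap_shift g a' \<and> b = gap_shift g b' \<and> c = Suc g)"
  using subseq_snoc_iff[of "[a,b]" c "map (gap_shift g) p" "Suc g"]
  unfolding gap_insert_def subseq_map_iff append_Cons append_Nil ex_Cons_eq_map_iff
  by (simp cong: conj_cong) blast

lemma subseq2_gap_insert:
  "subseq [a,b] (gap_insert g p) \<longleftrightarrow>
     (\<exists>a' b'. subseq [a',b'] p \<and> a = gap_shift g a' \<and> b = gap_shift g b')
   \<or> (\<exists>a'. a' \<in> set p \<and> a = gap_shift g a' \<and> b = Suc g)"
  using subseq_snoc_iff[of "[a]" b "map (gap_shift g) p" "Suc g"]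
  unfolding gap_insert_def subseq_map_iff append_Cons append_Nil ex_Cons_eq_map_iff
  by (simp add: subseq_singleton_left cong: conj_cong) blast

lemma ex_subseq4_gap_insert:
  "(\<exists>a b c d. subseq [a,b,c,d] (gap_insert g p) \<and> P a b c d) \<longleftrightarrow>
     (\<exists>a b c d. subseq [a,b,c,d] p \<and> P (gap_shift g a) (gap_shift g b) (gap_shift g c) (gap_shift g d))
   \<or> (\<exists>a b c. subseq [a,b,c] p \<and> P (gap_shift g a) (gap_shift g b) (gap_shift g c) (Suc g))"
  unfolding subseq4_gap_insert by blast

lemma all_subseq3_gap_insert:
  "(\<forall>a b c. subseq [a,b,c] (gap_insert g p) \<longrightarrow> P a b c) \<longleftrightarrow>
     (\<forall>a b c. subseq [a,b,c] p \<longrightarrow> P (gap_shift g a) (gap_shift g b) (gap_shift g c))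
   \<and> (\<forall>a b. subseq [a,b] p \<longrightarrow> P (gap_shift g a) (gap_shift g b) (Suc g))"
  unfolding subseq3_gap_insert by blast

lemma all_subseq2_gap_insert:
  "(\<forall>a b. subseq [a,b] (gap_insert g p) \<longrightarrow> P a b) \<longleftrightarrow>
     (\<forall>a b. subseq [a,b] p \<longrightarrow> P (gap_shift g a) (gap_shift g b))
   \<and> (\<forall>a \<in> set p. P (gap_shift g a) (Suc g))"
  unfolding subseq2_gap_insert by blast

lemma perms_of_len_length: "p \<in> perms_of_len n \<Longrightarrow> length p = n"
  by (auto simp: perms_of_len_def dest: distinct_card)

text \<open>A forbidden pattern that uses the new entry is a 312 \<open>a b c\<close> followed by
  it: it is 4231 if the gap lies below \<open>b\<close>, and 3124 if it lies above
  \<open>a\<close>.\<close>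

lemma in_class_gap_insert:
  assumes "p \<in> perms_of_len n" "g \<le> n"
  shows "in_class (gap_insert g p) \<longleftrightarrow> in_class p \<and> active p g"
proof -
  have "length p = n"
    using assms(1) by (rule perms_of_len_length)
  then show ?thesis
    using assms(2)
    unfolding in_class_def avoids_def contains_4231_iff contains_3124_iff active_def ex_subseq4_gap_insert
    by (simp add: not_le not_less) (meson linorder_not_le)
qed

text \<open>The 312s after the insertion are the old ones and those ending in the new entry. The
  latter correspond to the inversions that straddle \<open>g\<close>, which is what
  \<open>compatible\<close> tests.\<close>

lemma active_gap_insert:
  assumes "g \<le> length p"
  shows "active (gap_insert g p) h \<longleftrightarrow>
    h \<le> Suc (length p) \<and> active p (gap_collapse g h) \<and> compatible p g (gap_collapse g h)"
proof -
  have "gap_collapse g h \<le> length p" if "h \<le> Suc (length p)"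
    using that assms by (auto simp: gap_collapse_def)
  then show ?thesis
    unfolding active_def compatible_def all_subseq3_gap_insert
    by auto
qed

text \<open>The new entry is last and lies above gap \<open>k\<close>, so it is the lower end of no
  inversion straddling \<open>k\<close>.\<close>

lemma compatible_gap_insert_low:
  assumes "k \<le> g"
  shows "compatible (gap_insert g p) k h \<longleftrightarrow> compatible p k (gap_collapse g h)"
proof -
  have "gap_collapse g k = k"
    using assms by (simp add: gap_collapse_def)
  then show ?thesis
    using assms unfolding compatible_def all_subseq2_gap_insert by auto
qed

text \<open>Now the new entry forms a straddling inversion with every entry above gap
  \<open>k\<close>. The strictest one has the old entry \<open>k\<close>, raised to
  \<open>k + 1\<close>, as its upper end; it exists only if \<open>k \<le> n\<close>.\<close>

lemma compatible_gap_insert_high: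
  assumes "p \<in> perms_of_len n" "g < k" "k \<le> Suc n"
  shows "compatible (gap_insert g p) k h \<longleftrightarrow>
    compatible p (k - 1) (gap_collapse g h) \<and> (k \<le> n \<longrightarrow> g < h \<and> h \<le> k)"
proof -
  have gk: "gap_collapse g k = k - 1"
    using assms by (simp add: gap_collapse_def)
  have set: "set p = {1..n}"
    using assms(1) by (simp add: perms_of_len_def)
  have "(\<forall>a \<in> set p. k - 1 < a \<longrightarrow> Suc g \<le> h \<and> gap_collapse g h < a) \<longleftrightarrow> (k \<le> n \<longrightarrow> g < h \<and> h \<le> k)"
  proof (cases "k \<le> n")
    case True
    then have "k \<in> set p"
      using assms set by auto
    with True assms set show ?thesis
      by (auto simp: gap_collapse_def)
  next
    case False
    with assms set show ?thesis
      by auto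
  qed
  moreover have "compatible (gap_insert g p) k h \<longleftrightarrow> compatible p (k - 1) (gap_collapse g h) \<and>
      (\<forall>a \<in> set p. k - 1 < a \<longrightarrow> Suc g \<le> h \<and> gap_collapse g h < a)"
    using assms(2) unfolding compatible_def all_subseq2_gap_insert by (auto simp: gk)
  ultimately show ?thesis
    by simp
qed

lemma compatible_refl [simp]: "compatible p g g"
  by (simp add: compatible_def)

lemma gap_insert_perms_of_len:
  assumes "p \<in> perms_of_len n" "g \<le> n"
  shows "gap_insert g p \<in> perms_of_len (Suc n)"
proof -
  have "distinct (gap_insert g p)"
    using assms inj_gap_shift by (auto simp: perms_of_len_def gap_insert_def distinct_map intro: inj_on_subset)
  moreover have "insert (Suc g) (gap_shift g ` {1..n}) = {1..Suc n}"
  proof (intro equalityI subsetI)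
    fix x assume x: "x \<in> {1..Suc n}"
    have "x = gap_shift g x" if "x \<le> g"
      using that by (simp add: gap_shift_def)
    moreover have "x = gap_shift g (x - 1)" if "x > Suc g"
      using that by (simp add: gap_shift_def)
    moreover have "x \<in> {1..n}" if "x \<le> g"
      using x that assms by auto
    moreover have "x - 1 \<in> {1..n}" if "x > Suc g"
      using x that by auto
    ultimately show "x \<in> insert (Suc g) (gap_shift g ` {1..n})"
      by (metis image_eqI insert_iff linorder_neqE_nat not_less_eq_eq nat_less_le less_Suc_eq_le)
  qed (use assms in \<open>auto simp: gap_shift_def\<close>)
  ultimately show ?thesis
    using assms by (simp add: perms_of_len_def gap_insert_def)
qed

lemma gap_insert_inj:
  assumes "gap_insert g p = gap_insert h q"
  shows "g = h \<and> p = q"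
  using assms inj_gap_shift by (auto simp: gap_insert_def inj_map_eq_map)

lemma perms_of_len_Suc_obtain:
  assumes "q \<in> perms_of_len (Suc n)"
  obtains p g where "p \<in> perms_of_len n" "g \<le> n" "q = gap_insert g p"
proof -
  have dq: "distinct q" and sq: "set q = {1..Suc n}"
    using assms by (auto simp: perms_of_len_def)
  then have "q \<noteq> []"
    by auto
  then obtain q' v where q: "q = q' @ [v]"
    by (metis append_butlast_last_id)
  \<comment> \<open>\<open>v\<close> is at least 1, being an entry of a permutation, so the
    truncated subtraction is exact.\<close>
  define g where "g = v - 1"
  define p where "p = map (gap_collapse g) q'"
  have "v \<in> set q"
    by (simp add: q)
  then have v: "v = Suc g" "g \<le> n"
    unfolding sq by (auto simp: g_def)
  have sq': "set q' = {1..Suc n} - {Suc g}"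
    using dq sq q v by auto
  have shift: "gap_shift g (gap_collapse g x) = x" if "x \<noteq> Suc g" for x
    using that by (auto simp: gap_shift_def gap_collapse_def)
  have "map (gap_shift g) p = q'"
    unfolding p_def map_map by (rule map_idI) (simp add: sq' shift)
  then have "q = gap_insert g p"
    using q v by (simp add: gap_insert_def)
  moreover have "p \<in> perms_of_len n"
  proof -
    have "inj_on (gap_collapse g) (set q')"
      by (rule inj_onI) (metis sq' shift Diff_iff insertI1)
    then have "distinct p"
      using dq q by (simp add: p_def distinct_map)
    moreover have "gap_collapse g ` ({1..Suc n} - {Suc g}) = {1..n}"
    proof (intro equalityI subsetI)
      fix x assume "x \<in> {1..n}"
      then have "gap_shift g x \<in> {1..Suc n} - {Suc g}" "gap_collapse g (gap_shift g x) = x"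
        by (auto simp: gap_shift_def gap_collapse_def)
      then show "x \<in> gap_collapse g ` ({1..Suc n} - {Suc g})"
        by (metis image_eqI)
    qed (use v in \<open>auto simp: gap_collapse_def split: if_splits\<close>)
    ultimately show ?thesis
      by (simp add: perms_of_len_def p_def sq')
  qed
  ultimately show ?thesis
    using that v by blast
qed

section \<open>Counting the class along its generating tree\<close>

definition active_gaps :: "nat list \<Rightarrow> nat set" where
  "active_gaps p = {g. active p g}"

lemma finite_active_gaps [simp]: "finite (active_gaps p)"
  by (rule finite_subset[of _ "{..length p}"]) (auto simp: active_gaps_def active_def)

lemma finite_perms_of_len: "finite (perms_of_len n)"
proof (rule finite_subset)
  show "perms_of_len n \<subseteq> {xs. set xs \<subseteq> {1..n} \<and> length xs = n}"
    using perms_of_len_length by (auto simp: perms_of_len_def)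
qed (rule finite_lists_length_eq, simp)

lemma finite_class_of_len [simp]: "finite (class_of_len n)"
  using finite_perms_of_len by (simp add: class_of_len_def)

text \<open>Deleting the last entry gives each member of the class a unique parent, which is again
  in the class.\<close>

lemma sum_class_of_len_Suc:
  "(\<Sum>q \<in> class_of_len (Suc n). f q) = (\<Sum>p \<in> class_of_len n. \<Sum>g \<in> active_gaps p. f (gap_insert g p))"
proof -
  have "bij_betw (\<lambda>(p, g). gap_insert g p) (Sigma (class_of_len n) active_gaps) (class_of_len (Suc n))"
  proof (rule bij_betw_imageI)
    show "inj_on (\<lambda>(p, g). gap_insert g p) (Sigma (class_of_len n) active_gaps)"
      by (rule inj_onI) (auto dest: gap_insert_inj)
    show "(\<lambda>(p, g). gap_insert g p) ` Sigma (class_of_len n) active_gaps = class_of_len (Suc n)"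
    proof (intro equalityI subsetI)
      fix q assume "q \<in> (\<lambda>(p, g). gap_insert g p) ` Sigma (class_of_len n) active_gaps"
      then obtain p g where p: "p \<in> perms_of_len n" "in_class p" "active p g" "q = gap_insert g p"
        by (auto simp: class_of_len_def active_gaps_def)
      moreover have "g \<le> n"
        using p perms_of_len_length[of p n] by (auto simp: active_def)
      ultimately show "q \<in> class_of_len (Suc n)"
        by (simp add: class_of_len_def gap_insert_perms_of_len in_class_gap_insert)
    next
      fix q assume q: "q \<in> class_of_len (Suc n)"
      then have "q \<in> perms_of_len (Suc n)"
        by (simp add: class_of_len_def)
      then obtain p g where "p \<in> perms_of_len n" "g \<le> n" "q = gap_insert g p"
        by (rule perms_of_len_Suc_obtain)
      with q show "q \<in> (\<lambda>(p, g). gap_insert g p) ` Sigma (class_of_len n) active_gaps"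
        by (auto simp: class_of_len_def active_gaps_def in_class_gap_insert intro!: image_eqI[of _ _ "(p, g)"])
    qed
  qed
  from sum.reindex_bij_betw[OF this, of f] show ?thesis
    by (simp add: sum.Sigma case_prod_beta)
qed

fun descendants :: "nat \<Rightarrow> nat list \<Rightarrow> nat" where
  "descendants 0 p = 1"
| "descendants (Suc k) p = (\<Sum>g \<in> active_gaps p. descendants k (gap_insert g p))"

lemma sum_descendants_class_of_len:
  "(\<Sum>p \<in> class_of_len n. descendants k p) = card (class_of_len (n + k))"
proof (induction k arbitrary: n)
  case (Suc k)
  show ?case
    using Suc[of "Suc n"] by (simp add: sum_class_of_len_Suc)
qed simp

lemma class_of_len_0: "class_of_len 0 = {[]}"
  unfolding class_of_len_def perms_of_len_def in_class_def avoids_def contains_4231_iff contains_3124_iff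
  by auto

lemma a_4231_3124_eq_descendants: "a_4231_3124 n = descendants n []"
  using sum_descendants_class_of_len[of n 0]
  by (simp add: class_of_len_0) (simp add: a_4231_3124_def class_of_len_def in_class_def)

subsection \<open>Binary trees and their generating functions\<close>

datatype shape = Leaf | Node shape shape

text \<open>The order is inorder, so index \<open>s\<close> belongs to the node of value
  \<open>s + 1\<close>, the one just above gap \<open>s\<close>.\<close>

primrec left_subtrees :: "shape \<Rightarrow> shape list" where
  "left_subtrees Leaf = []"
| "left_subtrees (Node a b) = left_subtrees a @ a # left_subtrees b"

text \<open>Hangs \<open>a\<close> on the leftmost leaf. With the last entry as root, this is the
  tree of a concatenation whose first part, with tree \<open>a\<close>, lies below the second part
  in value.\<close>

primrec plug :: "shape \<Rightarrow> shape \<Rightarrow> shape" where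
  "plug a Leaf = a"
| "plug a (Node b c) = Node (plug a b) c"

definition shapes :: "nat \<Rightarrow> shape set" where
  "shapes n = {t. size t = n}"

lemma length_left_subtrees [simp]: "length (left_subtrees t) = size t"
  by (induction t) auto

lemma size_plug [simp]: "size (plug a r) = size a + size r"
  by (induction r) auto

lemma shapes_0 [simp]: "shapes 0 = {Leaf}"
proof -
  have "size t = 0 \<longleftrightarrow> t = Leaf" for t :: shape
    by (cases t) auto
  then show ?thesis
    by (auto simp: shapes_def)
qed

lemma bij_betw_Node_shapes:
  "bij_betw (\<lambda>(i, a, b). Node a b) (SIGMA i:{..n}. shapes i \<times> shapes (n - i)) (shapes (Suc n))"
proof (rule bij_betw_imageI)
  show "inj_on (\<lambda>(i, a, b). Node a b) (SIGMA i:{..n}. shapes i \<times> shapes (n - i))"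
    by (rule inj_onI) (auto simp: shapes_def)
  show "(\<lambda>(i, a, b). Node a b) ` (SIGMA i:{..n}. shapes i \<times> shapes (n - i)) = shapes (Suc n)"
  proof (intro equalityI subsetI)
    fix t assume "t \<in> shapes (Suc n)"
    then obtain a b where t: "t = Node a b" "size a + size b = n"
      by (cases t) (auto simp: shapes_def)
    then show "t \<in> (\<lambda>(i, a, b). Node a b) ` (SIGMA i:{..n}. shapes i \<times> shapes (n - i))"
      by (auto simp: shapes_def intro!: image_eqI[of _ _ "(size a, a, b)"])
  qed (auto simp: shapes_def)
qed

lemma finite_shapes [simp]: "finite (shapes n)"
proof (induction n rule: less_induct)
  case (less n)
  show ?case
  proof (cases n)
    case (Suc m)
    have "finite (SIGMA i:{..m}. shapes i \<times> shapes (m - i))"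
      using less Suc by (intro finite_SigmaI finite_cartesian_product) auto
    then show ?thesis
      using bij_betw_finite[OF bij_betw_Node_shapes[of m]] Suc by simp
  qed simp
qed

lemma sum_shapes_Suc:
  "(\<Sum>t \<in> shapes (Suc n). h t) = (\<Sum>i\<le>n. \<Sum>a \<in> shapes i. \<Sum>b \<in> shapes (n - i). h (Node a b))"
  using sum.reindex_bij_betw[OF bij_betw_Node_shapes[of n], of h]
  by (simp add: sum.Sigma sum.cartesian_product case_prod_beta)

lemma finite_plug_pairs [simp]: "finite {(a, r). plug a r = t}"
proof (rule finite_subset)
  show "{(a, r). plug a r = t} \<subseteq> (\<Union>i\<le>size t. shapes i) \<times> (\<Union>i\<le>size t. shapes i)"
    by (auto simp: shapes_def)
qed simp

text \<open>\<open>plug a r\<close> and \<open>Node a r\<close> are built from the same pair, so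
  each tree with \<open>n + 1\<close> nodes arises exactly once from a tree with \<open>n\<close>
  nodes.\<close>

lemma sum_shapes_plug:
  "(\<Sum>t \<in> shapes n. \<Sum>(a, r) \<in> {(a, r). plug a r = t}. h (Node a r)) = (\<Sum>t \<in> shapes (Suc n). h t)"
proof -
  have "bij_betw (\<lambda>(t, a, r). Node a r) (SIGMA t:shapes n. {(a, r). plug a r = t}) (shapes (Suc n))"
  proof (rule bij_betw_imageI)
    show "inj_on (\<lambda>(t, a, r). Node a r) (SIGMA t:shapes n. {(a, r). plug a r = t})"
      by (rule inj_onI) auto
    show "(\<lambda>(t, a, r). Node a r) ` (SIGMA t:shapes n. {(a, r). plug a r = t}) = shapes (Suc n)"
    proof (intro equalityI subsetI)
      fix t assume "t \<in> shapes (Suc n)"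
      then obtain a r where t: "t = Node a r" "size a + size r = n"
        by (cases t) (auto simp: shapes_def)
      then show "t \<in> (\<lambda>(t, a, r). Node a r) ` (SIGMA t:shapes n. {(a, r). plug a r = t})"
        by (auto simp: shapes_def intro!: image_eqI[of _ _ "(plug a r, a, r)"])
    qed (auto simp: shapes_def)
  qed
  from sum.reindex_bij_betw[OF this, of h] show ?thesis
    by (simp add: sum.Sigma case_prod_beta)
qed

section \<open>Counting descendants on trees alone\<close>

fun tail_count :: "nat \<Rightarrow> shape \<Rightarrow> nat \<Rightarrow> nat" where
  "tail_count 0 t m = 1"
| "tail_count (Suc k) t m =
     m * tail_count k Leaf 1 + tail_count k t (Suc m) + (\<Sum>u\<leftarrow>left_subtrees t. tail_count k u 1)"

text \<open>For the tree of a 312-avoider these are the gaps that some inversion straddles.\<close>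
definition inner_subtrees :: "shape \<Rightarrow> nat set" where
  "inner_subtrees t = {s. s < size t \<and> size (left_subtrees t ! s) < s}"

text \<open>The first sum is for entries that create no 312: the entry becomes the root over the
  parts \<open>a\<close> below it and \<open>r\<close> above it. The second sum is for entries that
  create the first 312.\<close>

fun head_count :: "nat \<Rightarrow> shape \<Rightarrow> nat" where
  "head_count 0 t = 1"
| "head_count (Suc k) t =
     (\<Sum>(a, r) \<in> {(a, r). plug a r = t}. head_count k (Node a r))
   + (\<Sum>s \<in> inner_subtrees t. tail_count k (left_subtrees t ! s) 1)"

text \<open>Summed over all trees of one size, the first sum of \<open>head_count\<close> is the
  same total one size up, so the recursion unrolls. The term for \<open>j\<close> collects the cases
  where \<open>j\<close> entries are appended before one creates a 312.\<close>

lemma sum_head_count: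
  "(\<Sum>t \<in> shapes n. head_count k t) = card (shapes (n + k)) +
     (\<Sum>j<k. \<Sum>t \<in> shapes (n + j). \<Sum>s \<in> inner_subtrees t. tail_count (k - Suc j) (left_subtrees t ! s) 1)"
proof (induction k arbitrary: n)
  case (Suc k)
  show ?case
    using Suc[of "Suc n"]
    by (simp add: sum.distrib sum_shapes_plug sum.lessThan_Suc_shift del: sum.lessThan_Suc)
qed simp

text \<open>The nodes of a left subtree precede its parent in inorder.\<close>

lemma size_left_subtrees_le: "s < size t \<Longrightarrow> size (left_subtrees t ! s) \<le> s"
proof (induction t arbitrary: s)
  case (Node a b)
  show ?case
  proof (cases "s \<le> size a")
    case True
    with Node.IH(1)[of s] show ?thesis
      by (auto simp: nth_append le_less)
  next
    case False
    then obtain j where "s = Suc (size a + j)"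
      using less_imp_Suc_add by (auto simp: not_le)
    with Node.IH(2)[of j] Node.prems show ?thesis
      by (auto simp: nth_append)
  qed
qed simp

lemma sum_list_left_subtrees:
  "(\<Sum>u\<leftarrow>left_subtrees t. h u) = (\<Sum>s<size t. h (left_subtrees t ! s))"
  by (simp add: sum_list_sum_nth atLeast0LessThan)

text \<open>Every node of \<open>b\<close> is inner, because \<open>a\<close> and the root precede
  it in inorder without being in its left subtree. The root is not inner, and the nodes of
  \<open>a\<close> keep their status.\<close>

lemma sum_inner_subtrees_Node:
  "(\<Sum>s \<in> inner_subtrees (Node a b). h (left_subtrees (Node a b) ! s)) =
     (\<Sum>s \<in> inner_subtrees a. h (left_subtrees a ! s)) + (\<Sum>u\<leftarrow>left_subtrees b. h u)"
proof -
  have "inner_subtrees (Node a b) = inner_subtrees a \<union> (\<lambda>s. Suc (size a + s)) ` {..<size b}" (is "?L = ?R")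
  proof (intro set_eqI)
    fix s
    consider "s < size a" | "s = size a" | j where "s = Suc (size a + j)"
      by (metis less_imp_Suc_add linorder_neqE_nat)
    then show "s \<in> ?L \<longleftrightarrow> s \<in> ?R"
    proof cases
      case (3 j)
      then show ?thesis
        using size_left_subtrees_le[of j b] by (auto simp: inner_subtrees_def nth_append)
    qed (auto simp: inner_subtrees_def nth_append)
  qed
  moreover have "inner_subtrees a \<inter> (\<lambda>s. Suc (size a + s)) ` {..<size b} = {}"
    by (auto simp: inner_subtrees_def)
  moreover have "finite (inner_subtrees a)"
    by (simp add: inner_subtrees_def)
  moreover have "(\<Sum>s \<in> inner_subtrees a. h (left_subtrees (Node a b) ! s)) = (\<Sum>s \<in> inner_subtrees a. h (left_subtrees a ! s))"
    by (rule sum.cong) (auto simp: inner_subtrees_def nth_append)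
  moreover have "(\<Sum>s<size b. h (left_subtrees (Node a b) ! Suc (size a + s))) = (\<Sum>s<size b. h (left_subtrees b ! s))"
    by (rule sum.cong) (auto simp: nth_append)
  ultimately show ?thesis
    by (simp add: sum.union_disjoint sum.reindex inj_on_def sum_list_left_subtrees del: left_subtrees.simps)
qed

lemma inner_subtrees_Leaf [simp]: "inner_subtrees Leaf = {}"
  by (simp add: inner_subtrees_def)

section \<open>Generating functions of single states\<close>

definition step_weight :: "real fps" where
  "step_weight = fps_X * inverse (1 - fps_X)"

text \<open>The series of the state \<open>Leaf\<close> with \<open>m = 1\<close>: the solution of
  \<open>f = 1 + x * (f + f * (1 + z))\<close>, where \<open>z\<close> is
  \<open>step_weight\<close>.\<close>

definition leaf_fps :: "real fps" where
  "leaf_fps = (1 - fps_X) * inverse (1 - 3 * fps_X + fps_X^2)"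

lemma step_weight: "step_weight * (1 - fps_X) = fps_X"
  by (simp add: step_weight_def mult.assoc inverse_mult_eq_1)

lemma leaf_fps: "leaf_fps * (1 - 3 * fps_X + fps_X^2) = 1 - fps_X"
proof -
  have "(1 - 3 * fps_X + fps_X^2 :: real fps) $ 0 \<noteq> 0"
    by (simp add: fps_X_power_nth numeral_fps_const)
  then show ?thesis
    by (simp add: leaf_fps_def mult.assoc inverse_mult_eq_1)
qed

text \<open>The series of the state of a tree with \<open>m = 1\<close>, divided by
  \<open>leaf_fps\<close>. The recursion at the root, unlike the sum in \<open>chain_fps_eq\<close>,
  is fit for summation over all trees.\<close>

primrec chain_fps :: "shape \<Rightarrow> real fps" where
  "chain_fps Leaf = 1"
| "chain_fps (Node a b) = (1 + step_weight) * chain_fps a + chain_fps b - 1"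

primrec inner_chain_fps :: "shape \<Rightarrow> real fps" where
  "inner_chain_fps Leaf = 0"
| "inner_chain_fps (Node a b) = inner_chain_fps a + chain_fps b - 1"

lemma chain_fps_eq: "chain_fps t = 1 + step_weight * (\<Sum>u\<leftarrow>left_subtrees t. chain_fps u)"
  by (induction t) (auto simp: algebra_simps)

lemma inner_chain_fps_eq:
  "inner_chain_fps t = step_weight * (\<Sum>s \<in> inner_subtrees t. chain_fps (left_subtrees t ! s))"
proof (induction t)
  case (Node a b)
  show ?case
    using Node(1) chain_fps_eq[of b]
    unfolding sum_inner_subtrees_Node by (simp add: algebra_simps)
qed simp

lemma fps_one_minus_X_neq_0: "(1 - fps_X :: real fps) \<noteq> 0"
proof
  assume "(1 - fps_X :: real fps) = 0"
  then have "(1 - fps_X :: real fps) $ 0 = 0 $ 0"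
    by simp
  then show False
    by simp
qed

text \<open>An ansatz affine in \<open>m\<close>: the recursion of \<open>tail_count\<close> forces
  the slope \<open>w\<close> to satisfy \<open>w = x * (leaf_fps + w)\<close>, hence
  \<open>w = leaf_fps * step_weight\<close>.\<close>

definition tail_fps :: "shape \<Rightarrow> nat \<Rightarrow> real fps" where
  "tail_fps t m = leaf_fps * (chain_fps t + (of_nat m - 1) * step_weight)"

lemma tail_fps_rec:
  "tail_fps t m = 1 + fps_X * (of_nat m * tail_fps Leaf 1 + tail_fps t (Suc m) + (\<Sum>u\<leftarrow>left_subtrees t. tail_fps u 1))"
proof -
  define S where "S = (\<Sum>u\<leftarrow>left_subtrees t. chain_fps u)"
  have sum: "(\<Sum>u\<leftarrow>left_subtrees t. tail_fps u 1) = leaf_fps * S"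
    by (simp add: tail_fps_def S_def sum_list_const_mult)
  \<comment> \<open>The factor \<open>1 - X\<close> clears the denominator of
    \<open>step_weight\<close>, so that the identity is polynomial; it is cancelled
    afterwards.\<close>
  have "(1 - X) * (f * (1 + z * S + (m - 1) * z)) =
      (1 - X) * (1 + X * (m * f + f * (1 + z * S + m * z) + f * S))"
    if "f * (1 - 3 * X + X^2) = 1 - X" "z * (1 - X) = X" for f z X S m :: "real fps"
    using that by algebra
  from this[OF leaf_fps step_weight, of S "of_nat m"] show ?thesis
    unfolding sum using fps_one_minus_X_neq_0
    by (simp add: tail_fps_def chain_fps_eq[of t] S_def[symmetric])
qed

lemma tail_fps_nth: "tail_fps t m $ k = of_nat (tail_count k t m)"
proof (induction k arbitrary: t m)
  case 0
  show ?case
    by (subst tail_fps_rec) simp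
next
  case (Suc k)
  have "(of_nat m * g :: real fps) $ k = of_nat m * (g $ k)" for g
    by (simp flip: fps_of_nat)
  then show ?case
    by (subst tail_fps_rec) (simp add: Suc.IH sum_list_left_subtrees fps_sum_nth)
qed

section \<open>Double series and sums over all trees\<close>

definition fps_diagonal :: "'a::comm_ring_1 fps fps \<Rightarrow> 'a fps" where
  "fps_diagonal A = Abs_fps (\<lambda>n. \<Sum>j\<le>n. A $ j $ (n - j))"

lemma fps_diagonal_add: "fps_diagonal (A + B) = fps_diagonal A + fps_diagonal B"
  and fps_diagonal_diff: "fps_diagonal (A - B) = fps_diagonal A - fps_diagonal B"
  by (auto simp: fps_diagonal_def fps_eq_iff sum.distrib sum_subtractf)

lemma fps_diagonal_const: "fps_diagonal (fps_const a) = a"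
proof -
  have "(\<Sum>j\<le>n. fps_const a $ j $ (n - j)) = (\<Sum>j\<in>{0::nat}. a $ n)" for n
    by (rule sum.mono_neutral_cong_right) auto
  then show ?thesis
    by (simp add: fps_diagonal_def fps_eq_iff)
qed

text \<open>The diagonal substitutes the inner variable for the outer one. Below any fixed degree
  this is evaluation of a polynomial, which turns multiplicativity into a matter of finite
  sums.\<close>

lemma fps_diagonal_nth:
  assumes "n \<le> N"
  shows "fps_diagonal A $ n = (\<Sum>j\<le>N. A $ j * fps_X ^ j) $ n"
proof -
  have "(\<Sum>j\<le>N. A $ j * fps_X ^ j) $ n = (\<Sum>j\<le>N. if n < j then 0 else A $ j $ (n - j))"
    by (simp add: fps_sum_nth fps_X_power_mult_right_nth)
  also have "\<dots> = (\<Sum>j\<le>n. A $ j $ (n - j))"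
    using assms by (intro sum.mono_neutral_cong_right) auto
  finally show ?thesis
    by (simp add: fps_diagonal_def)
qed

lemma fps_diagonal_mult: "fps_diagonal (A * B) = fps_diagonal A * fps_diagonal B"
proof (rule fps_ext)
  fix N
  let ?P = "\<lambda>A. \<Sum>j\<le>N. A $ j * fps_X ^ j"
  have "(fps_diagonal A * fps_diagonal B) $ N = (?P A * ?P B) $ N"
    unfolding fps_mult_nth by (rule sum.cong) (simp_all add: fps_diagonal_nth[of _ N])
  also have "?P A * ?P B = (\<Sum>(i, j)\<in>{..N} \<times> {..N}. A $ i * B $ j * fps_X ^ (i + j))"
    by (simp add: sum_product sum.cartesian_product power_add mult_ac)
  also have "\<dots> $ N = (\<Sum>(i, j)\<in>{..N} \<times> {..N}. (A $ i * B $ j * fps_X ^ (i + j)) $ N)"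
    by (simp add: fps_sum_nth case_prod_beta)
  \<comment> \<open>Products with \<open>i + j > N\<close> have no term of degree
    \<open>N\<close>.\<close>
  also have "\<dots> = (\<Sum>(i, j)\<in>{(i, j). i + j \<le> N}. (A $ i * B $ j * fps_X ^ (i + j)) $ N)"
    by (rule sum.mono_neutral_cong_right) (auto simp: fps_X_power_mult_right_nth split: if_splits)
  also have "\<dots> = (\<Sum>k\<le>N. \<Sum>i\<le>k. (A $ i * B $ (k - i) * fps_X ^ k) $ N)"
    by (simp add: sum.triangle_reindex_eq)
  also have "\<dots> = fps_diagonal (A * B) $ N"
    by (simp add: fps_diagonal_nth[of N N] fps_sum_nth fps_mult_nth[of A B] atLeast0AtMost sum_distrib_right)
  finally show "fps_diagonal (A * B) $ N = (fps_diagonal A * fps_diagonal B) $ N"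
    by simp
qed

lemma fps_diagonal_X: "fps_diagonal fps_X = fps_X"
proof (rule fps_ext)
  fix n
  have "(\<Sum>j\<le>n. (fps_X :: 'a fps fps) $ j $ (n - j)) = (\<Sum>j\<in>(if n = 1 then {1::nat} else {}). 1)"
    by (rule sum.mono_neutral_cong_right) (auto simp: fps_X_def split: if_splits)
  then show "fps_diagonal fps_X $ n = (fps_X :: 'a fps) $ n"
    by (auto simp: fps_diagonal_def fps_X_def)
qed

definition shape_sum :: "(shape \<Rightarrow> 'a::comm_ring_1) \<Rightarrow> 'a fps" where
  "shape_sum h = Abs_fps (\<lambda>n. \<Sum>t \<in> shapes n. h t)"

text \<open>The sizes of the two subtrees add up to one less than the size of the tree, so the sums
  form Cauchy products. The three products match the recursions of \<open>chain_fps\<close> and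
  \<open>inner_chain_fps\<close>.\<close>

lemma shape_sum_Node:
  assumes "\<And>a b. h (Node a b) = f1 a * g1 b + f2 a * g2 b - f3 a * g3 b"
  shows "shape_sum h = fps_const (h Leaf) +
    fps_X * (shape_sum f1 * shape_sum g1 + shape_sum f2 * shape_sum g2 - shape_sum f3 * shape_sum g3)"
proof (rule fps_ext)
  fix n
  have "(shape_sum f * shape_sum g) $ m = (\<Sum>i\<le>m. \<Sum>a \<in> shapes i. \<Sum>b \<in> shapes (m - i). f a * g b)"
    for m and f g :: "shape \<Rightarrow> 'a"
    by (simp add: fps_mult_nth shape_sum_def sum_product atLeast0AtMost)
  then show "shape_sum h $ n = (fps_const (h Leaf) +
    fps_X * (shape_sum f1 * shape_sum g1 + shape_sum f2 * shape_sum g2 - shape_sum f3 * shape_sum g3)) $ n"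
    by (cases n) (simp_all add: shape_sum_def[of h] sum_shapes_Suc assms sum.distrib sum_subtractf)
qed

lemma shape_sum_const_mult: "shape_sum (\<lambda>t. c * h t) = fps_const c * shape_sum h"
  by (simp add: shape_sum_def fps_eq_iff sum_distrib_left)

definition catalan_fps :: "real fps" where
  "catalan_fps = fps_diagonal (shape_sum (\<lambda>_. 1))"

definition chain_total :: "real fps" where
  "chain_total = fps_diagonal (shape_sum chain_fps)"

definition inner_chain_total :: "real fps" where
  "inner_chain_total = fps_diagonal (shape_sum inner_chain_fps)"

lemmas fps_diagonal_simps =
  fps_diagonal_add fps_diagonal_diff fps_diagonal_mult fps_diagonal_const fps_diagonal_X

lemma catalan_fps_eq: "catalan_fps = 1 + fps_X * (catalan_fps * catalan_fps)"
proof -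
  \<comment> \<open>The constant 1 is read as \<open>1 * 1 + 1 * 1 - 1 * 1\<close> to fit the three
    products.\<close>
  have "shape_sum (\<lambda>_. 1 :: real fps) = fps_const 1 + fps_X * (shape_sum (\<lambda>_. 1) * shape_sum (\<lambda>_. 1) +
      shape_sum (\<lambda>_. 1) * shape_sum (\<lambda>_. 1) - shape_sum (\<lambda>_. 1) * shape_sum (\<lambda>_. 1))"
    by (rule shape_sum_Node) simp
  from arg_cong[OF this, of fps_diagonal] show ?thesis
    unfolding fps_diagonal_simps catalan_fps_def by simp
qed

lemma chain_total_eq:
  "chain_total = 1 + fps_X * ((1 + step_weight) * chain_total * catalan_fps
    + catalan_fps * chain_total - catalan_fps * catalan_fps)"
proof -
  have "shape_sum chain_fps = fps_const (chain_fps Leaf) +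
      fps_X * (shape_sum (\<lambda>t. (1 + step_weight) * chain_fps t) * shape_sum (\<lambda>_. 1) +
      shape_sum (\<lambda>_. 1) * shape_sum chain_fps - shape_sum (\<lambda>_. 1) * shape_sum (\<lambda>_. 1))"
    by (rule shape_sum_Node) simp
  from arg_cong[OF this, of fps_diagonal] show ?thesis
    unfolding fps_diagonal_simps shape_sum_const_mult catalan_fps_def chain_total_def by simp
qed

lemma inner_chain_total_eq:
  "inner_chain_total = fps_X * (inner_chain_total * catalan_fps
    + catalan_fps * chain_total - catalan_fps * catalan_fps)"
proof -
  have "shape_sum inner_chain_fps = fps_const (inner_chain_fps Leaf) +
      fps_X * (shape_sum inner_chain_fps * shape_sum (\<lambda>_. 1) +
      shape_sum (\<lambda>_. 1) * shape_sum chain_fps - shape_sum (\<lambda>_. 1) * shape_sum (\<lambda>_. 1))"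
    by (rule shape_sum_Node) simp
  from arg_cong[OF this, of fps_diagonal] show ?thesis
    unfolding fps_diagonal_simps catalan_fps_def chain_total_def inner_chain_total_def by simp
qed

lemma catalan_fps_nth: "catalan_fps $ n = real (card (shapes n))"
proof -
  have "(\<Sum>j\<le>n. of_nat (card (shapes j)) $ (n - j) :: real) = (\<Sum>j\<in>{n}. real (card (shapes n)))"
    by (rule sum.mono_neutral_cong_right) auto
  then show ?thesis
    by (simp add: catalan_fps_def fps_diagonal_def shape_sum_def)
qed

text \<open>The Catalan series counts the 312-avoiders; the other permutations are split at the
  entry that creates the first 312. This entry contributes a factor \<open>fps_X\<close>, which is
  \<open>step_weight * (1 - fps_X)\<close>, and the \<open>step_weight\<close> is absorbed by
  \<open>inner_chain_fps\<close>.\<close>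

lemma head_count_fps:
  "Abs_fps (\<lambda>n. real (head_count n Leaf)) = catalan_fps + (1 - fps_X) * leaf_fps * inner_chain_total"
proof -
  define B where "B = (\<lambda>t. \<Sum>s \<in> inner_subtrees t. tail_fps (left_subtrees t ! s) 1)"
  have "fps_X * B t = ((1 - fps_X) * leaf_fps) * inner_chain_fps t" for t
  proof -
    define S where "S = (\<Sum>s \<in> inner_subtrees t. chain_fps (left_subtrees t ! s))"
    have "B t = leaf_fps * S"
      by (simp add: B_def S_def tail_fps_def sum_distrib_left)
    moreover have "inner_chain_fps t = step_weight * S"
      by (simp add: S_def inner_chain_fps_eq)
    ultimately show ?thesis
      using step_weight by algebra
  qed
  then have "shape_sum (\<lambda>t. fps_X * B t) = shape_sum (\<lambda>t. ((1 - fps_X) * leaf_fps) * inner_chain_fps t)"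
    by simp
  then have B: "fps_X * fps_diagonal (shape_sum B) = (1 - fps_X) * leaf_fps * inner_chain_total"
    unfolding shape_sum_const_mult inner_chain_total_def
    by (metis fps_diagonal_const fps_diagonal_mult)
  have "Abs_fps (\<lambda>n. real (head_count n Leaf)) = catalan_fps + fps_X * fps_diagonal (shape_sum B)"
  proof (rule fps_ext)
    fix n
    show "Abs_fps (\<lambda>n. real (head_count n Leaf)) $ n = (catalan_fps + fps_X * fps_diagonal (shape_sum B)) $ n"
    proof (cases n)
      case 0
      then show ?thesis
        by (simp add: catalan_fps_nth)
    next
      case (Suc m)
      have "head_count n Leaf = card (shapes n) +
          (\<Sum>j<n. \<Sum>t \<in> shapes j. \<Sum>s \<in> inner_subtrees t. tail_count (n - Suc j) (left_subtrees t ! s) 1)"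
        \<comment> \<open>\<open>Leaf\<close> is the only tree of size 0, so the total over trees is
          a single count.\<close>
        using sum_head_count[of n 0] by simp
      then show ?thesis
        unfolding Suc
        by (simp add: catalan_fps_nth fps_diagonal_def shape_sum_def B_def fps_sum_nth tail_fps_nth lessThan_Suc_atMost
            del: head_count.simps)
    qed
  qed
  then show ?thesis
    using B by simp
qed

section \<open>Elimination and the closed form\<close>

lemma sqrt_1m4x_eq: "sqrt_1m4x = 1 - 2 * fps_X * catalan_fps"
proof -
  \<comment> \<open>Completing the square in the Catalan equation.\<close>
  have "(1 - 2 * fps_X * catalan_fps) ^ 2 = 1 - 4 * fps_X"
    using catalan_fps_eq by algebra
  moreover have "(1 - 2 * fps_X * catalan_fps) $ 0 = 1"
    by (simp add: mult.assoc)
  ultimately have "1 - 2 * fps_X * catalan_fps = fps_radical (\<lambda>_ _. 1) (Suc 1) (1 - 4 * fps_X)"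
    by (intro iffD1[OF radical_unique]) (auto simp: numeral_2_eq_2 mult.assoc)
  then show ?thesis
    by (simp add: sqrt_1m4x_def numeral_2_eq_2)
qed

lemma head_count_closed_form:
  "Abs_fps (\<lambda>n. real (head_count n Leaf)) - 1 =
    (1 - 8 * fps_X + 20 * fps_X^2 - 20 * fps_X^3 + 10 * fps_X^4 - 2 * fps_X^5
      - (1 - 4 * fps_X + 2 * fps_X^2) * sqrt_1m4x)
    / (2 * (1 - 3 * fps_X + fps_X^2) * (-1 + 5 * fps_X - 4 * fps_X^2 + fps_X^3))" (is "?f = ?num / ?den")
proof -
  \<comment> \<open>Here \<open>c\<close>, \<open>q\<close>, \<open>d\<close> stand for the Catalan,
    chain and inner chain totals, \<open>f\<close> for \<open>leaf_fps\<close> and \<open>z\<close>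
    for \<open>step_weight\<close>; what remains is polynomial elimination.\<close>
  have key: "(c - 1 + (1 - X) * f * d) * (2 * (1 - 3 * X + X^2) * (-1 + 5 * X - 4 * X^2 + X^3)) =
      1 - 8 * X + 20 * X^2 - 20 * X^3 + 10 * X^4 - 2 * X^5 - (1 - 4 * X + 2 * X^2) * (1 - 2 * X * c)"
    if c: "c = 1 + X * (c * c)"
      and q: "q = 1 + X * ((1 + z) * q * c + c * q - c * c)"
      and d: "d = X * (d * c + c * q - c * c)"
      and f: "f * (1 - 3 * X + X^2) = 1 - X"
      and z: "z * (1 - X) = X"
    for c q d f z X :: "real fps"
  proof -
    let ?K = "-1 + 5 * X - 4 * X^2 + X^3"
    have c': "c * (1 - X * c) = 1"
      using c by algebra
    \<comment> \<open>The equation for \<open>d\<close> reads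
      \<open>d * (1 - X * c) = X * c * (q - c)\<close>, and \<open>c\<close> is the inverse of
      \<open>1 - X * c\<close>.\<close>
    have d': "d = X * c^2 * (q - c)"
      using d c' by algebra
    have "(1 - X) * q = (1 - X) * (2 - c) + (2 - X) * X * q * c"
      using q z c by algebra
    \<comment> \<open>The multiplier is the conjugate of the coefficient of \<open>q\<close> under
      \<open>X * c \<mapsto> 1 - X * c\<close>, which swaps the roots of the Catalan equation. The
      product of the two is free of \<open>c\<close> and equals \<open>?K\<close>.\<close>
    then have "((2 - X) * X * c - 1) * ((1 - X) * q - (2 - X) * X * q * c) = ((2 - X) * X * c - 1) * ((1 - X) * (2 - c))"
      by simp
    moreover have "((2 - X) * X * c - 1) * ((1 - X) * q - (2 - X) * X * q * c) = q * ?K"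
      using c by algebra
    ultimately have Kq: "q * ?K = ((2 - X) * X * c - 1) * ((1 - X) * (2 - c))"
      by simp
    have "(c - 1 + (1 - X) * f * d) * (2 * (1 - 3 * X + X^2) * ?K) =
        2 * (c - 1) * (1 - 3 * X + X^2) * ?K + 2 * (1 - X)^2 * (X * c^2) * (q * ?K - c * ?K)"
      using f d' by algebra
    also have "X * c^2 = c - 1"
      using c by algebra
    finally show ?thesis
      unfolding Kq using c by algebra
  qed
  have "?f * ?den = ?num"
    using key[OF catalan_fps_eq chain_total_eq inner_chain_total_eq leaf_fps step_weight]
    by (simp add: head_count_fps sqrt_1m4x_eq algebra_simps)
  moreover have "?den \<noteq> 0"
  proof -
    have "?den $ 0 \<noteq> 0 $ 0"
      by (simp add: numeral_fps_const fps_X_power_nth)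
    then show ?thesis
      by metis
  qed
  ultimately show ?thesis
    by (metis nonzero_mult_div_cancel_right)
qed

subsection \<open>Permutations as states\<close>

abbreviation left_size :: "shape \<Rightarrow> nat \<Rightarrow> nat" where
  "left_size t s \<equiv> size (left_subtrees t ! s)"

text \<open>In inorder a left subtree occupies the positions directly before its parent.\<close>

lemma left_subtrees_left_subtree:
  assumes "s < size t" "i < left_size t s"
  shows "left_subtrees t ! (s - left_size t s + i) = left_subtrees (left_subtrees t ! s) ! i"
  using assms
proof (induction t arbitrary: s)
  case (Node a b)
  consider "s < size a" | "s = size a" | j where "s = Suc (size a + j)"
    by (metis less_imp_Suc_add linorder_neqE_nat)
  then show ?case
  proof cases
    case 1
    with Node.prems have i: "i < left_size a s"
      by (simp add: nth_append)
    then have "s - left_size a s + i < size a"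
      using 1 size_left_subtrees_le[of s a] by linarith
    with 1 i Node.IH(1)[of s] show ?thesis
      by (simp add: nth_append)
  next
    case 2
    with Node show ?thesis
      by (auto simp: nth_append)
  next
    case (3 j)
    with Node.prems have j: "j < size b" "i < left_size b j"
      by (auto simp: nth_append)
    then have "left_size b j \<le> j"
      by (intro size_left_subtrees_le)
    then have "s - left_size b j + i = Suc (size a + (j - left_size b j + i))"
      using 3 by simp
    with Node.IH(2)[OF j] 3 show ?thesis
      by (auto simp: nth_append)
  qed
qed simp

lemma left_subtrees_plug_low:
  "s < size a \<Longrightarrow> left_subtrees (plug a r) ! s = left_subtrees a ! s"
  by (induction r) (auto simp: nth_append)

text \<open>The nodes with \<open>left_size r j = j\<close> form the left spine of \<open>r\<close>;
  their left subtrees take in \<open>a\<close>, all others are unchanged.\<close>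

lemma left_size_plug_high:
  assumes "j < size r"
  shows "left_size (plug a r) (size a + j) = (if left_size r j = j then size a + j else left_size r j)"
  using assms
proof (induction r arbitrary: j)
  case (Node b c)
  consider "j < size b" | "j = size b" | i where "j = Suc (size b + i)"
    by (metis less_imp_Suc_add linorder_neqE_nat)
  then show ?case
  proof cases
    case (3 i)
    with Node.prems size_left_subtrees_le[of i c] show ?thesis
      by (auto simp: nth_append)
  qed (use Node in \<open>auto simp: nth_append\<close>)
qed simp

lemma plug_inject:
  assumes "plug a r = plug a' r'" "size a = size a'"
  shows "a = a' \<and> r = r'"
proof -
  have "size r = 0 \<longleftrightarrow> r = Leaf" for r :: shape
    by (cases r) auto
  moreover have "size r = size r'"
    using assms by (metis add_left_imp_eq size_plug)
  ultimately show ?thesis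
    using assms
  proof (induction r arbitrary: r')
    case (Node b c)
    then show ?case
      by (cases r') auto
  qed auto
qed

text \<open>All nodes of a right subtree are inner, so the search for \<open>s\<close> only descends
  to the left, and the tree is cut on its left spine.\<close>

lemma plug_exists:
  assumes "s \<le> size t" "s \<notin> inner_subtrees t"
  shows "\<exists>a r. plug a r = t \<and> size a = s"
  using assms
proof (induction t)
  case Leaf
  then show ?case
    by (metis le_zero_eq plug.simps(1) shape.size(3))
next
  case (Node b c)
  show ?case
  proof (cases "s = size (Node b c)")
    case True
    then show ?thesis
      by (metis plug.simps(1))
  next
    case False
    have "s \<le> size b"
    proof (rule ccontr)
      assume "\<not> s \<le> size b"
      then obtain j where j: "s = Suc (size b + j)"
        by (metis less_imp_Suc_add not_le)
      then have "j < size c"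
        using Node.prems False by simp
      then have "s \<in> inner_subtrees (Node b c)"
        using j size_left_subtrees_le[of j c] by (auto simp: inner_subtrees_def nth_append)
      with Node.prems show False
        by simp
    qed
    moreover have "s \<notin> inner_subtrees b"
      using Node.prems by (auto simp: inner_subtrees_def nth_append)
    ultimately obtain a r where "plug a r = b" "size a = s"
      using Node.IH(1) by blast
    then have "plug a (Node r c) = Node b c \<and> size a = s"
      by simp
    then show ?thesis
      by blast
  qed
qed

text \<open>The first node of \<open>r\<close> in inorder lies on its left spine, so in
  \<open>plug a r\<close> its left subtree is exactly as large as its index.\<close>

lemma size_plug_notin_inner_subtrees: "size a \<notin> inner_subtrees (plug a r)"
proof (cases r)
  case (Node b c)
  with size_left_subtrees_le[of 0 r] left_size_plug_high[of 0 r a] show ?thesis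
    by (auto simp: inner_subtrees_def)
qed (simp add: inner_subtrees_def)

lemma bij_betw_plug:
  "bij_betw (\<lambda>(a, r). size a) {(a, r). plug a r = t} ({..size t} - inner_subtrees t)"
proof (rule bij_betw_imageI)
  show "inj_on (\<lambda>(a, r). size a) {(a, r). plug a r = t}"
    by (rule inj_onI) (auto dest: plug_inject)
  show "(\<lambda>(a, r). size a) ` {(a, r). plug a r = t} = {..size t} - inner_subtrees t" (is "?L = ?R")
  proof (intro equalityI subsetI)
    fix s assume "s \<in> ?L"
    then show "s \<in> ?R"
      using size_plug_notin_inner_subtrees by auto
  next
    fix s assume "s \<in> ?R"
    then obtain a r where "plug a r = t" "size a = s"
      using plug_exists by blast
    then show "s \<in> ?L"
      by (auto intro!: image_eqI[of _ _ "(a, r)"])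
  qed
qed

section \<open>Tail states: permutations that contain a 312\<close>

definition chain_window :: "nat list \<Rightarrow> nat \<Rightarrow> nat \<Rightarrow> shape \<Rightarrow> bool" where
  "chain_window p lo hi t \<longleftrightarrow> (\<forall>s<size t. \<forall>h\<in>{lo..hi}.
     compatible p (lo + s) h \<longleftrightarrow> h \<in> {lo + s - left_size t s..lo + s})"

text \<open>The strict bound by \<open>n\<close> guarantees an entry above all active gaps, which
  supplies the case \<open>k \<le> n\<close> of \<open>compatible_gap_insert_high\<close> when an
  entry is appended.\<close>

definition tail_state :: "nat \<Rightarrow> nat list \<Rightarrow> nat \<Rightarrow> shape \<Rightarrow> nat \<Rightarrow> bool" where
  "tail_state n p lo t m \<longleftrightarrow> p \<in> perms_of_len n \<and> lo + size t + m < n \<and>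
     active_gaps p = {lo..lo + size t + m} \<and>
     chain_window p lo (lo + size t + m) t \<and>
     (\<forall>h\<in>{lo..lo + size t + m}. compatible p (lo + size t) h) \<and>
     (\<forall>i\<in>{1..m}. \<forall>h\<in>{lo..lo + size t + m}. compatible p (lo + size t + i) h \<longleftrightarrow> h = lo + size t + i)"

lemma active_gaps_gap_insert:
  assumes "p \<in> perms_of_len n" "g \<le> n"
  shows "active_gaps (gap_insert g p) =
    {h. gap_collapse g h \<in> active_gaps p \<and> compatible p g (gap_collapse g h)}"
proof -
  have "length p = n"
    using assms(1) by (rule perms_of_len_length)
  moreover have "h \<le> Suc n" if "gap_collapse g h \<le> n" for h
    using that assms(2) by (auto simp: gap_collapse_def split: if_splits)
  ultimately show ?thesis
    using assms(2) by (auto simp: active_gaps_def active_gap_insert) (auto simp: active_def)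
qed

lemma gap_collapse_mem_iff:
  "lo \<le> g \<Longrightarrow> g \<le> hi \<Longrightarrow> gap_collapse g h \<in> {lo..hi} \<longleftrightarrow> h \<in> {lo..Suc hi}"
  by (auto simp: gap_collapse_def)

lemma gap_collapse_mem_low_iff:
  "hi < g \<Longrightarrow> gap_collapse g h \<in> {lo..hi} \<longleftrightarrow> h \<in> {lo..hi}"
  by (auto simp: gap_collapse_def)

text \<open>Serves every step that ends with \<open>m = 1\<close>. Of the surviving gaps,
  \<open>g\<close> splits in two: the lower half separates \<open>u\<close> from the new entry, the
  upper half is the one gap above that entry.\<close>

lemma tail_state_gap_insert_chain:
  assumes p: "p \<in> perms_of_len n" and g: "g < n" "size u \<le> g"
    and act: "{h \<in> active_gaps p. compatible p g h} = {g - size u..g}"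
    and win: "chain_window p (g - size u) g u"
  shows "tail_state (Suc n) (gap_insert g p) (g - size u) u 1"
proof -
  let ?lo = "g - size u"
  have lo: "?lo + size u = g" "?lo \<le> g"
    using g by auto
  have mem: "gap_collapse g h \<in> {?lo..g} \<longleftrightarrow> h \<in> {?lo..Suc g}" for h
    using lo by (intro gap_collapse_mem_iff) auto
  have comp: "compatible p g (gap_collapse g h)" if "h \<in> {?lo..Suc g}" for h
    using that act mem by blast
  have "chain_window (gap_insert g p) ?lo (Suc g) u"
    unfolding chain_window_def
  proof (intro allI impI ballI)
    fix s h assume s: "s < size u" and h: "h \<in> {?lo..Suc g}"
    have "?lo + s < g"
      using s lo by linarith
    moreover have "compatible p (?lo + s) (gap_collapse g h) \<longleftrightarrow>
        gap_collapse g h \<in> {?lo + s - left_size u s..?lo + s}"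
      using win s h mem by (auto simp: chain_window_def)
    ultimately show "compatible (gap_insert g p) (?lo + s) h \<longleftrightarrow> h \<in> {?lo + s - left_size u s..?lo + s}"
      by (simp add: compatible_gap_insert_low gap_collapse_mem_low_iff del: atLeastAtMost_iff)
  qed
  moreover have "active_gaps (gap_insert g p) = {?lo..Suc g}"
    unfolding active_gaps_gap_insert[OF p less_imp_le[OF g(1)]] using act mem by blast
  moreover have "compatible (gap_insert g p) (Suc g) h \<longleftrightarrow> h = Suc g" if "h \<in> {?lo..Suc g}" for h
    using p g comp[OF that] by (subst compatible_gap_insert_high) auto
  ultimately show ?thesis
    using gap_insert_perms_of_len[OF p, of g] g lo comp
    by (auto simp: tail_state_def compatible_gap_insert_low)
qed

lemma chain_window_left_subtree:
  assumes "chain_window p lo hi t" "s < size t" "lo + s \<le> hi"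
  defines "u \<equiv> left_subtrees t ! s"
  shows "chain_window p (lo + s - size u) (lo + s) u"
  unfolding chain_window_def
proof (intro allI impI ballI)
  fix i h assume i: "i < size u" and h: "h \<in> {lo + s - size u..lo + s}"
  have le: "size u \<le> s"
    using assms by (simp add: size_left_subtrees_le)
  have sub: "left_size t (s - size u + i) = left_size u i"
    using left_subtrees_left_subtree assms i by simp
  have "s - size u + i < size t" "h \<in> {lo..hi}"
    using assms i h le by auto
  then have "compatible p (lo + (s - size u + i)) h \<longleftrightarrow>
      h \<in> {lo + (s - size u + i) - left_size u i..lo + (s - size u + i)}"
    using assms(1) sub by (auto simp: chain_window_def)
  moreover have "lo + (s - size u + i) = lo + s - size u + i"
    using le by simp
  ultimately show "compatible p (lo + s - size u + i) h \<longleftrightarrow>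
      h \<in> {lo + s - size u + i - left_size u i..lo + s - size u + i}"
    by simp
qed

lemma tail_state_step_chain:
  assumes "tail_state n p lo t m" "s < size t"
  shows "tail_state (Suc n) (gap_insert (lo + s) p) (lo + s - left_size t s) (left_subtrees t ! s) 1"
proof (rule tail_state_gap_insert_chain)
  have le: "left_size t s \<le> s"
    using assms by (simp add: size_left_subtrees_le)
  show "{h \<in> active_gaps p. compatible p (lo + s) h} = {lo + s - left_size t s..lo + s}"
    using assms le by (auto simp: tail_state_def chain_window_def)
  show "chain_window p (lo + s - left_size t s) (lo + s) (left_subtrees t ! s)"
    using assms by (intro chain_window_left_subtree[of _ _ "lo + size t + m"]) (auto simp: tail_state_def)
qed (use assms size_left_subtrees_le[of s t] in \<open>auto simp: tail_state_def\<close>)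

text \<open>Such a gap is compatible with no other active gap, so the surviving tree is
  empty.\<close>

lemma tail_state_step_right:
  assumes "tail_state n p lo t m" "i \<in> {1..m}"
  shows "tail_state (Suc n) (gap_insert (lo + size t + i) p) (lo + size t + i) Leaf 1"
proof -
  have "tail_state (Suc n) (gap_insert (lo + size t + i) p) (lo + size t + i - size Leaf) Leaf 1"
    by (rule tail_state_gap_insert_chain) (use assms in \<open>auto simp: tail_state_def chain_window_def\<close>)
  then show ?thesis
    by simp
qed

text \<open>The gap \<open>lo + size t\<close> is compatible with all active gaps, so none is lost,
  and the new entry becomes the lowest of the decreasing sequence.\<close>

lemma tail_state_step_top:
  assumes "tail_state n p lo t m"
  shows "tail_state (Suc n) (gap_insert (lo + size t) p) lo t (Suc m)"
proof -
  let ?g = "lo + size t"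
  let ?hi = "lo + size t + m"
  have p: "p \<in> perms_of_len n" and n: "?hi < n" and act: "active_gaps p = {lo..?hi}"
    and win: "chain_window p lo ?hi t" and top: "\<And>h. h \<in> {lo..?hi} \<Longrightarrow> compatible p ?g h"
    and right: "\<And>i h. i \<in> {1..m} \<Longrightarrow> h \<in> {lo..?hi} \<Longrightarrow> compatible p (?g + i) h \<longleftrightarrow> h = ?g + i"
    using assms by (auto simp: tail_state_def)
  have le: "?g \<le> n"
    using n by simp
  have mem: "gap_collapse ?g h \<in> {lo..?hi} \<longleftrightarrow> h \<in> {lo..Suc ?hi}" for h
    by (intro gap_collapse_mem_iff) auto
  have "chain_window (gap_insert ?g p) lo (Suc ?hi) t"
    unfolding chain_window_def
  proof (intro allI impI ballI)
    fix s h assume s: "s < size t" and h: "h \<in> {lo..Suc ?hi}"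
    have "compatible p (lo + s) (gap_collapse ?g h) \<longleftrightarrow> gap_collapse ?g h \<in> {lo + s - left_size t s..lo + s}"
      using win s h mem by (auto simp: chain_window_def)
    with s show "compatible (gap_insert ?g p) (lo + s) h \<longleftrightarrow> h \<in> {lo + s - left_size t s..lo + s}"
      by (simp add: compatible_gap_insert_low gap_collapse_mem_low_iff del: atLeastAtMost_iff)
  qed
  moreover have "active_gaps (gap_insert ?g p) = {lo..Suc ?hi}"
    unfolding active_gaps_gap_insert[OF p le] using act mem top by blast
  moreover have "compatible (gap_insert ?g p) ?g h" if "h \<in> {lo..Suc ?hi}" for h
    using that mem top by (simp add: compatible_gap_insert_low)
  moreover have "compatible (gap_insert ?g p) (?g + i) h \<longleftrightarrow> h = ?g + i"
    if i: "i \<in> {1..Suc m}" and h: "h \<in> {lo..Suc ?hi}" for i h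
  proof -
    have "compatible (gap_insert ?g p) (?g + i) h \<longleftrightarrow>
        compatible p (?g + i - 1) (gap_collapse ?g h) \<and> ?g < h \<and> h \<le> ?g + i"
      using compatible_gap_insert_high[OF p, of ?g "?g + i" h] i n by auto
    also have "\<dots> \<longleftrightarrow> h = ?g + i"
    \<comment> \<open>For \<open>i = 1\<close> the two bounds on \<open>h\<close> leave a single
      value; for larger \<open>i\<close> this is the old gap with index \<open>i - 1\<close>, raised
      by one.\<close>
    proof (cases "i = 1")
      case True
      with h mem top show ?thesis
        by auto
    next
      case False
      then have "compatible p (?g + (i - 1)) (gap_collapse ?g h) \<longleftrightarrow> gap_collapse ?g h = ?g + (i - 1)"
        using i h mem by (intro right) auto
      with False i show ?thesis
        by (auto simp: gap_collapse_def)
    qed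
    finally show ?thesis .
  qed
  ultimately show ?thesis
    using gap_insert_perms_of_len[OF p, of ?g] n by (simp add: tail_state_def)
qed

lemma descendants_tail_state:
  "tail_state n p lo t m \<Longrightarrow> descendants k p = tail_count k t m"
proof (induction k arbitrary: n p lo t m)
  case (Suc k)
  let ?f = "\<lambda>g. descendants k (gap_insert g p)"
  have "active_gaps p = (\<lambda>s. lo + s) ` {..<size t} \<union> {lo + size t} \<union> (\<lambda>i. lo + size t + i) ` {1..m}" (is "_ = ?A \<union> _ \<union> ?C")
  proof (intro set_eqI)
    fix g
    have "g \<in> ?A \<longleftrightarrow> lo \<le> g \<and> g < lo + size t"
      by (auto intro!: image_eqI[of _ _ "g - lo"])
    moreover have "g \<in> ?C \<longleftrightarrow> lo + size t < g \<and> g \<le> lo + size t + m"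
      by (auto intro!: image_eqI[of _ _ "g - (lo + size t)"])
    ultimately show "g \<in> active_gaps p \<longleftrightarrow> g \<in> ?A \<union> {lo + size t} \<union> ?C"
      using Suc.prems by (auto simp: tail_state_def)
  qed
  then have "(\<Sum>g \<in> active_gaps p. ?f g) = (\<Sum>g \<in> ?A. ?f g) + ?f (lo + size t) + (\<Sum>g \<in> ?C. ?f g)"
    by (simp only:) (subst sum.union_disjoint, simp, simp, force, simp add: image_iff)
  also have "(\<Sum>g \<in> ?A. ?f g) = (\<Sum>u\<leftarrow>left_subtrees t. tail_count k u 1)"
    using Suc.IH[OF tail_state_step_chain[OF Suc.prems]]
    by (simp add: sum.reindex sum_list_left_subtrees)
  also have "(\<Sum>g \<in> ?C. ?f g) = m * tail_count k Leaf 1"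
    using Suc.IH[OF tail_state_step_right[OF Suc.prems]] by (subst sum.reindex) simp_all
  also have "?f (lo + size t) = tail_count k t (Suc m)"
    by (rule Suc.IH[OF tail_state_step_top[OF Suc.prems]])
  finally show ?case
    by simp
qed simp

section \<open>Head states: permutations that avoid 312\<close>

definition head_state :: "nat list \<Rightarrow> shape \<Rightarrow> bool" where
  "head_state p t \<longleftrightarrow> p \<in> perms_of_len (size t) \<and> active_gaps p = {..size t} \<and>
     (\<forall>s\<le>size t. \<forall>h\<le>size t. compatible p s h \<longleftrightarrow>
        (s \<in> inner_subtrees t \<longrightarrow> h \<in> {s - left_size t s..s}))"

lemma head_state_step_inner:
  assumes state: "head_state p t" and s: "s \<in> inner_subtrees t"
  defines "u \<equiv> left_subtrees t ! s"
  shows "tail_state (Suc (size t)) (gap_insert s p) (s - size u) u 1"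
proof (rule tail_state_gap_insert_chain)
  have lt: "size u < s" "s < size t"
    using s by (auto simp: inner_subtrees_def u_def)
  then show "{h \<in> active_gaps p. compatible p s h} = {s - size u..s}"
    using state s by (auto simp: head_state_def u_def)
  show "chain_window p (s - size u) s u"
    unfolding chain_window_def
  proof (intro allI impI ballI)
    fix i h assume i: "i < size u" and h: "h \<in> {s - size u..s}"
    let ?k = "s - size u + i"
    have sub: "left_size t ?k = left_size u i"
      using left_subtrees_left_subtree[of s t i] lt i by (simp add: u_def)
    moreover have "left_size u i \<le> i"
      using i by (rule size_left_subtrees_le)
    moreover have "?k < size t" "i < ?k"
      using lt i by linarith+
    \<comment> \<open>As \<open>size u < s\<close>, some nodes precede all of \<open>u\<close> in
      inorder, so every node of \<open>u\<close> is inner in \<open>t\<close>.\<close>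
    ultimately have "?k \<in> inner_subtrees t"
      by (simp add: inner_subtrees_def)
    then show "compatible p ?k h \<longleftrightarrow> h \<in> {?k - left_size u i..?k}"
      using state lt i h sub by (simp add: head_state_def)
  qed
qed (use state s in \<open>auto simp: head_state_def inner_subtrees_def u_def\<close>)

text \<open>No inversion straddles the gap \<open>size a\<close>, so no 312 arises; the new entry
  only adds inversions with the entries of \<open>r\<close>, all of whose nodes become
  inner.\<close>

lemma head_state_step_plug:
  assumes state: "head_state p (plug a r)"
  shows "head_state (gap_insert (size a) p) (Node a r)"
proof -
  let ?t = "plug a r"
  let ?g = "size a"
  let ?n = "size ?t"
  have p: "p \<in> perms_of_len ?n" and act: "active_gaps p = {..?n}"
    and comp: "\<And>s h. s \<le> ?n \<Longrightarrow> h \<le> ?n \<Longrightarrow> compatible p s h \<longleftrightarrow>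
      (s \<in> inner_subtrees ?t \<longrightarrow> h \<in> {s - left_size ?t s..s})"
    using state by (auto simp: head_state_def)
  have mem: "gap_collapse ?g h \<le> ?n \<longleftrightarrow> h \<le> Suc ?n" for h
    by (auto simp: gap_collapse_def)
  have g: "compatible p ?g h" if "h \<le> ?n" for h
    using that comp[of ?g h] size_plug_notin_inner_subtrees[of a r] by simp
  have "active_gaps (gap_insert ?g p) = {..Suc ?n}"
    using active_gaps_gap_insert[OF p, of ?g] act mem g by auto
  moreover have "compatible (gap_insert ?g p) k h \<longleftrightarrow>
      (k \<in> inner_subtrees (Node a r) \<longrightarrow> h \<in> {k - left_size (Node a r) k..k})"
    if k: "k \<le> Suc ?n" and h: "h \<le> Suc ?n" for k h
  proof -
    consider "k < ?g" | "k = ?g" | "k = Suc ?n" | j where "k = Suc (?g + j)" "j < size r"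
      using k by (metis add_less_cancel_left le_less less_Suc_eq_le less_imp_Suc_add linorder_neqE_nat add_Suc size_plug)
    then show ?thesis
    proof cases
      case 1
      then have "left_size ?t k = left_size (Node a r) k" "k \<in> inner_subtrees ?t \<longleftrightarrow> k \<in> inner_subtrees (Node a r)"
        by (auto simp: left_subtrees_plug_low nth_append inner_subtrees_def)
      moreover have "compatible (gap_insert ?g p) k h \<longleftrightarrow>
          (k \<in> inner_subtrees ?t \<longrightarrow> gap_collapse ?g h \<in> {k - left_size ?t k..k})"
        using 1 comp[of k "gap_collapse ?g h"] h mem by (simp add: compatible_gap_insert_low)
      ultimately show ?thesis
        using 1 by (simp add: gap_collapse_mem_low_iff del: atLeastAtMost_iff)
    next
      case 2
      then have "k \<notin> inner_subtrees (Node a r)"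
        by (simp add: inner_subtrees_def nth_append)
      with 2 g h mem show ?thesis
        by (simp add: compatible_gap_insert_low)
    next
      case 3
      then have "k \<notin> inner_subtrees (Node a r)" "?n \<notin> inner_subtrees ?t"
        by (simp_all add: inner_subtrees_def)
      moreover have "compatible (gap_insert ?g p) k h \<longleftrightarrow> compatible p ?n (gap_collapse ?g h)"
        using 3 compatible_gap_insert_high[OF p, of ?g k h] by simp
      ultimately show ?thesis
        using comp[of ?n "gap_collapse ?g h"] h mem by simp
    next
      \<comment> \<open>If \<open>j\<close> is on the left spine of \<open>r\<close>, then
        \<open>?g + j\<close> was not inner, and the new entry alone cuts the window to
        \<open>{?g + 1..k}\<close>, which is \<open>{k - ?l..k}\<close> since \<open>?l = j\<close>.
        Otherwise the old window already lies above \<open>?g\<close>.\<close>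
      case (4 j)
      let ?l = "left_size r j"
      have le: "?l \<le> j"
        using 4 by (simp add: size_left_subtrees_le)
      have new: "left_size (Node a r) k = ?l" "k \<in> inner_subtrees (Node a r)"
        using 4 le by (auto simp: inner_subtrees_def nth_append)
      have "compatible (gap_insert ?g p) k h \<longleftrightarrow> compatible p (?g + j) (gap_collapse ?g h) \<and> ?g < h \<and> h \<le> k"
        using 4 compatible_gap_insert_high[OF p, of ?g k h] by simp
      also have "compatible p (?g + j) (gap_collapse ?g h) \<longleftrightarrow>
          (?g + j \<in> inner_subtrees ?t \<longrightarrow> gap_collapse ?g h \<in> {?g + j - left_size ?t (?g + j)..?g + j})"
        using 4 h mem by (intro comp) auto
      also have "\<dots> \<longleftrightarrow> (?l < j \<longrightarrow> gap_collapse ?g h \<in> {?g + j - ?l..?g + j})"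
        using 4 le left_size_plug_high[of j r a] by (auto simp: inner_subtrees_def)
      also have "(?l < j \<longrightarrow> gap_collapse ?g h \<in> {?g + j - ?l..?g + j}) \<and> ?g < h \<and> h \<le> k \<longleftrightarrow> h \<in> {k - ?l..k}"
        using 4 le by (auto simp: gap_collapse_def)
      finally show ?thesis
        using new by simp
    qed
  qed
  ultimately show ?thesis
    using gap_insert_perms_of_len[OF p, of ?g] by (simp add: head_state_def)
qed

lemma descendants_head_state:
  "head_state p t \<Longrightarrow> descendants k p = head_count k t"
proof (induction k arbitrary: p t)
  case (Suc k)
  let ?f = "\<lambda>g. descendants k (gap_insert g p)"
  have sub: "inner_subtrees t \<subseteq> {..size t}"
    by (auto simp: inner_subtrees_def)
  have "(\<Sum>g \<in> active_gaps p. ?f g) =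
      (\<Sum>g \<in> {..size t} - inner_subtrees t. ?f g) + (\<Sum>g \<in> inner_subtrees t. ?f g)"
    using Suc.prems sum.subset_diff[OF sub, of ?f] by (simp add: head_state_def)
  also have "(\<Sum>g \<in> {..size t} - inner_subtrees t. ?f g) =
      (\<Sum>(a, r) \<in> {(a, r). plug a r = t}. ?f (size a))"
    using sum.reindex_bij_betw[OF bij_betw_plug[of t], of ?f] by (simp add: case_prod_beta)
  also have "\<dots> = (\<Sum>(a, r) \<in> {(a, r). plug a r = t}. head_count k (Node a r))"
    using Suc.prems by (intro sum.cong) (auto intro!: Suc.IH head_state_step_plug)
  also have "(\<Sum>g \<in> inner_subtrees t. ?f g) = (\<Sum>s \<in> inner_subtrees t. tail_count k (left_subtrees t ! s) 1)"
    by (intro sum.cong refl descendants_tail_state[OF head_state_step_inner[OF Suc.prems]])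
  finally show ?case
    by simp
qed simp

lemma a_4231_3124_eq_head_count: "a_4231_3124 n = head_count n Leaf"
proof -
  have "head_state [] Leaf"
    by (auto simp: head_state_def perms_of_len_def active_gaps_def active_def compatible_def)
  then show ?thesis
    by (simp add: a_4231_3124_eq_descendants descendants_head_state)
qed

theorem theorem5p2:
  shows "gf_4231_3124 =
    (1 - 8 * fps_X + 20 * fps_X^2 - 20 * fps_X^3 + 10 * fps_X^4 - 2 * fps_X^5
      - (1 - 4 * fps_X + 2 * fps_X^2) * sqrt_1m4x)
    / (2 * (1 - 3 * fps_X + fps_X^2) * (-1 + 5 * fps_X - 4 * fps_X^2 + fps_X^3))"
proof -
  \<comment> \<open>Subtracting 1 removes the empty permutation, counted by
    \<open>head_count 0 Leaf\<close>.\<close>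
  have "gf_4231_3124 = Abs_fps (\<lambda>n. real (head_count n Leaf)) - 1"
    by (rule fps_ext) (simp add: gf_4231_3124_def a_4231_3124_eq_head_count)
  then show ?thesis
    by (simp only: head_count_closed_form)
qed

end
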